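(* For every $r\in\{1,2,3,4,5,6,7\}$ there exists a unitary matrix $U$ on $\mathbb{C}^2\otimes\mathbb{C}^2\otimes\mathbb{C}^2$ with $\mathrm{sr}(U)=r$.
   Context: For a matrix $U$ on $\mathbb{C}^2\otimes\mathbb{C}^2\otimes\mathbb{C}^2$ (systems $A,B,C$), its Schmidt rank $\mathrm{sr}(U)$ is the least integer $r$ such that $U=\sum_{j=1}^r A_j\otimes B_j\otimes C_j$ with $A_j,B_j,C_j$ complex $2\times 2$ matrices (i.e. the tensor rank of $U$). *)

theory Defs
  imports "HOL-Analysis.Analysis"
begin

text \<open>Operators on C^2 (x) C^2 (x) C^2, with basis indexed by the finite type
  2 \<times> 2 \<times> 2 (systems A, B, C).  Complex 2x2 matrices are complex^2^2.\<close>

type_synonym qubit_op = "complex^2^2"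
type_synonym idx3 = "2 \<times> 2 \<times> 2"
type_synonym op3 = "complex^idx3^idx3"

definition kron3 :: "qubit_op \<Rightarrow> qubit_op \<Rightarrow> qubit_op \<Rightarrow> op3" where
  "kron3 A B C = (\<chi> p q. A $ fst p $ fst q * B $ fst (snd p) $ fst (snd q) * C $ snd (snd p) $ snd (snd q))"

definition adjoint_mat :: "complex^'n^'n \<Rightarrow> complex^'n^'n" where
  "adjoint_mat U = (\<chi> i j. cnj (U$j$i))"

definition unitary_mat :: "complex^'n^'n \<Rightarrow> bool" where
  "unitary_mat U \<longleftrightarrow> U ** adjoint_mat U = mat 1 \<and> adjoint_mat U ** U = mat 1"

definition schmidt_rank :: "op3 \<Rightarrow> nat" where
  "schmidt_rank U = (LEAST r. \<exists>A B C :: nat \<Rightarrow> qubit_op.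
      U = (\<Sum>j<r. kron3 (A j) (B j) (C j)))"

end

theory Submission
  imports Defs
begin

text \<open>
  Adding one product operator changes the Schmidt rank by at most one. Hence, if unitaries
  $U_1, \dots, U_4$ successively differ by product operators, $U_1$ is a product and a
  one-party flattening of $U_4$ has rank 4, then $U_k$ has Schmidt rank $k$. Likewise a unitary
  with five terms that is one product operator away from a unitary of rank at least 6 settles
  ranks 5 and 6; the latter is a swap controlled by the first qubit, paired with a unitary that
  corresponds to a square-zero matrix of rank 2, and the substitution method applies.

  For rank 7, the cyclic permutation of the three qubits is the tensor
  $\mathrm{tr}(XYZ)$ of $2 \times 2$ matrix multiplication. Strassen's algorithm gives seven
  terms. Suppose six terms suffice, with functionals $\alpha_j$ in $X$. An invertible
  $X$ is annihilated by at most two of the $\alpha_j$, a nonzero $X$ by at most four. From a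
  singular $p$ annihilated by three of them one finds an invertible $M$ annihilated by
  two of those; the pencil $M - tp$ then contains a singular $q$ such that $p$ and $q$ are
  annihilated by four $\alpha_j$ each, two of them in common. In a basis with
  $p = E_{11}$ and $q$ a multiple of $E_{22}$ the two common functionals vanish at $E_{12}$,
  which is incompatible with the decomposition.
\<close>

subsection \<open>Sums of product operators\<close>

definition mat2 :: "'a \<Rightarrow> 'a \<Rightarrow> 'a \<Rightarrow> 'a \<Rightarrow> 'a^2^2" where
  "mat2 a b c d = (\<chi> i j. if i = 1 then (if j = 1 then a else b) else (if j = 1 then c else d))"

lemma mat2_nth [simp]:
  "mat2 a b c d $ 1 $ 1 = a" "mat2 a b c d $ 1 $ 2 = b"
  "mat2 a b c d $ 2 $ 1 = c" "mat2 a b c d $ 2 $ 2 = d"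
  by (simp_all add: mat2_def)

lemma mat2_eqI:
  fixes X Y :: "'a^2^2"
  assumes "X$1$1 = Y$1$1" "X$1$2 = Y$1$2" "X$2$1 = Y$2$1" "X$2$2 = Y$2$2"
  shows "X = Y"
  using assms by (simp add: vec_eq_iff forall_2)

lemma matrix_mult_2:
  fixes X Y :: "'a::semiring_1^2^2"
  shows "(X ** Y) $ i $ k = X$i$1 * Y$1$k + X$i$2 * Y$2$k"
  by (simp add: matrix_matrix_mult_def sum_2)

lemma trace_2: "trace (X :: 'a::semiring_1^2^2) = X$1$1 + X$2$2"
  by (simp add: trace_def sum_2)

lemma trace_add: "trace (X + Y) = trace X + trace (Y :: 'a::comm_semiring_1^'n^'n)"
  by (simp add: trace_def sum.distrib)

lemma trace_sum: "trace (\<Sum>j\<in>J. F j) = (\<Sum>j\<in>J. trace (F j :: 'a::comm_semiring_1^'n^'n))"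
  by (simp add: trace_def sum.swap[of _ _ J])

lemma sum_matrix_mult:
  "(\<Sum>j\<in>J. F j) ** Y = (\<Sum>j\<in>J. F j ** (Y :: 'a::comm_semiring_1^'n^'n))"
  by (simp add: matrix_matrix_mult_def vec_eq_iff sum_distrib_right sum.swap[of _ _ J])

lemma sum_idx3:
  "(\<Sum>p\<in>(UNIV :: idx3 set). f p) = (\<Sum>a\<in>UNIV. \<Sum>b\<in>UNIV. \<Sum>c\<in>UNIV. f (a, b, c))"
  by (simp add: sum.cartesian_product split_def)

lemma matrix_mult_add_left: "(A + B) ** C = A ** C + B ** (C :: 'a::semiring_1^'n^'n)"
  by (simp add: matrix_matrix_mult_def vec_eq_iff sum.distrib distrib_right)

lemma kron3_mult: "kron3 A B C ** kron3 X Y Z = kron3 (A ** X) (B ** Y) (C ** Z)"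
  by (simp add: kron3_def matrix_matrix_mult_def vec_eq_iff sum_idx3 sum_2 algebra_simps)

lemma trace_kron3: "trace (kron3 A B C) = trace A * trace B * trace C"
  by (simp add: trace_def kron3_def sum_idx3 sum_2 algebra_simps)

section \<open>Decompositions into a given number of product operators\<close>

definition sum_of_kron3 :: "nat \<Rightarrow> op3 \<Rightarrow> bool" where
  "sum_of_kron3 r U \<longleftrightarrow> (\<exists>A B C :: nat \<Rightarrow> qubit_op. U = (\<Sum>j<r. kron3 (A j) (B j) (C j)))"

lemma schmidt_rank_eqI:
  assumes "sum_of_kron3 r U" "\<And>s. sum_of_kron3 s U \<Longrightarrow> r \<le> s"
  shows "schmidt_rank U = r"
  using assms unfolding schmidt_rank_def sum_of_kron3_def by (intro Least_equality) blast+

lemma sum_of_kron3_0: "sum_of_kron3 0 0"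
  by (simp add: sum_of_kron3_def)

lemma sum_of_kron3_Suc:
  assumes "sum_of_kron3 r U"
  shows "sum_of_kron3 (Suc r) (U + kron3 A B C)"
proof -
  obtain A' B' C' where U: "U = (\<Sum>j<r. kron3 (A' j) (B' j) (C' j))"
    using assms by (auto simp: sum_of_kron3_def)
  have "U + kron3 A B C =
    (\<Sum>j<Suc r. kron3 ((A'(r := A)) j) ((B'(r := B)) j) ((C'(r := C)) j))"
    unfolding U by simp
  then show ?thesis unfolding sum_of_kron3_def by blast
qed

lemma sum_of_kron3_mono:
  assumes "sum_of_kron3 r U" "r \<le> s"
  shows "sum_of_kron3 s U"
  using assms(2,1)
proof (induction s rule: dec_induct)
  case (step s)
  have "kron3 0 0 0 = 0" by (simp add: kron3_def vec_eq_iff)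
  with sum_of_kron3_Suc[of s U 0 0 0] step show ?case by simp
qed

text \<open>Pairing with \<open>kron3 X Y Z\<close> under the trace turns a decomposition of an
  operator into one of a trilinear form, each term a product of three linear functionals. The lower
  bounds work with this form.\<close>

lemma trace_sum_kron3:
  "trace ((\<Sum>j\<in>J. kron3 (A j) (B j) (C j)) ** kron3 X Y Z)
   = (\<Sum>j\<in>J. trace (A j ** X) * trace (B j ** Y) * trace (C j ** Z))"
  by (simp add: sum_matrix_mult trace_sum kron3_mult trace_kron3)

definition monomial_mat :: "('n \<Rightarrow> 'n) \<Rightarrow> ('n \<Rightarrow> complex) \<Rightarrow> complex^'n^'n" where
  "monomial_mat \<pi> s = (\<chi> p q. if q = \<pi> p then s p else 0)"

text \<open>A left inverse makes \<pi> injective, so distinct rows have disjoint supports and are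
  orthogonal. The other product follows because the matrix is square.\<close>

lemma unitary_monomial_mat:
  fixes U :: "complex^'n^'n"
  assumes U: "U = monomial_mat \<pi> s" and inv: "\<forall>p. \<sigma> (\<pi> p) = p" and s: "\<forall>p. s p * cnj (s p) = 1"
  shows "unitary_mat U"
proof -
  have inj: "\<pi> p = \<pi> q \<longleftrightarrow> p = q" for p q using inv by metis
  have "U ** adjoint_mat U = mat 1"
    using s unfolding U
    by (auto simp: monomial_mat_def adjoint_mat_def matrix_matrix_mult_def mat_def vec_eq_iff
      if_distrib[of cnj] if_distrib[of "\<lambda>x. _ * x"] if_distrib[of "\<lambda>x. x * _"] inj cong: if_cong)
  then show ?thesis
    unfolding unitary_mat_def using matrix_left_right_inverse by blast
qed

text \<open>Three linear conditions on four entries leave a nonzero solution. This lets one test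
  matrix remove any three terms of a decomposition.\<close>

lemma common_kernel_3:
  fixes A B C :: qubit_op
  obtains X where "X \<noteq> 0" "trace (A ** X) = 0" "trace (B ** X) = 0" "trace (C ** X) = 0"
proof -
  define coords :: "qubit_op \<Rightarrow> complex^4" where
    "coords M = (\<chi> j. if j = 1 then M$1$1 else if j = 2 then M$1$2 else if j = 3 then M$2$1 else M$2$2)" for M
  \<comment> \<open>A zero fourth row makes the system square and singular.\<close>
  define M :: "complex^4^4" where
    "M = (\<chi> i. if i = 1 then coords A else if i = 2 then coords B else if i = 3 then coords C else 0)"
  have "det M = 0" by (rule det_zero_row(1)[of 4]) (simp add: M_def row_def vec_eq_iff)
  then have "\<not> invertible M" by (simp add: invertible_det_nz)
  then obtain x where x: "M *v x = 0" "x \<noteq> 0"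
    using invertible_left_inverse matrix_left_invertible_ker by blast
  \<comment> \<open>Coordinates 2 and 3 are exchanged because the trace pairs \<open>A$1$2\<close>
    with \<open>X$2$1\<close>.\<close>
  define X where "X = mat2 (x$1) (x$3) (x$2) (x$4)"
  have "(M *v x) $ 1 = 0" "(M *v x) $ 2 = 0" "(M *v x) $ 3 = 0" using x by simp_all
  then have "trace (A ** X) = 0" "trace (B ** X) = 0" "trace (C ** X) = 0"
    by (simp_all add: matrix_vector_mult_def sum_4 M_def coords_def X_def trace_2 matrix_mult_2 algebra_simps)
  moreover have "X \<noteq> 0"
  proof
    assume X0: "X = 0"
    have "x$1 = X$1$1" "x$2 = X$2$1" "x$3 = X$1$2" "x$4 = X$2$2" by (simp_all add: X_def)
    with X0 x(2) show False by (simp add: vec_eq_iff forall_4)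
  qed
  ultimately show ?thesis using that by blast
qed

subsection \<open>Schmidt ranks one to four\<close>

definition chain1 :: op3 where
  "chain1 = kron3 (mat 1) (mat 1) (mat 1)"
text \<open>The factor \<open>mat2 (-1) 1 1 (-1)\<close> is a bit flip minus the identity, so here
  and in the next two definitions the added term turns an identity into a flip on one block.\<close>

definition chain2 :: op3 where
  "chain2 = chain1 + kron3 (mat2 0 0 0 1) (mat2 1 0 0 0) (mat2 (-1) 1 1 (-1))"
definition chain3 :: op3 where
  "chain3 = chain2 + kron3 (mat2 (-1) 1 1 (-1)) (mat2 0 0 0 1) (mat 1)"
definition chain4 :: op3 where
  "chain4 = chain3 + kron3 (mat2 0 1 0 0) (mat2 0 0 0 1) (mat2 (-1) 1 1 (-1))"

abbreviation flip :: "2 \<Rightarrow> 2" where "flip i \<equiv> (if i = 1 then 2 else 1)"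

lemma unitary_chain1: "unitary_mat chain1"
proof -
  have "chain1 = monomial_mat (\<lambda>p. p) (\<lambda>_. 1)"
    by (simp add: chain1_def kron3_def mat_def monomial_mat_def vec_eq_iff)
  then show ?thesis by (rule unitary_monomial_mat[where \<sigma> = "\<lambda>p. p"]) simp_all
qed

lemma unitary_chain2: "unitary_mat chain2"
proof -
  define \<pi> :: "idx3 \<Rightarrow> idx3" where "\<pi> = (\<lambda>(a, b, c). (a, b, if a = 2 \<and> b = 1 then flip c else c))"
  have "chain2 = monomial_mat \<pi> (\<lambda>_. 1)"
    by (simp add: chain2_def chain1_def kron3_def mat_def monomial_mat_def vec_eq_iff \<pi>_def forall_2)
  moreover have "\<forall>p. \<pi> (\<pi> p) = p" by (simp add: \<pi>_def forall_2)
  ultimately show ?thesis by (rule unitary_monomial_mat) simp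
qed

lemma unitary_chain3: "unitary_mat chain3"
proof -
  define \<pi> :: "idx3 \<Rightarrow> idx3" where
    "\<pi> = (\<lambda>(a, b, c). if b = 1 then (a, b, if a = 2 then flip c else c) else (flip a, b, c))"
  have "chain3 = monomial_mat \<pi> (\<lambda>_. 1)"
    by (simp add: chain3_def chain2_def chain1_def kron3_def mat_def monomial_mat_def vec_eq_iff \<pi>_def forall_2)
  moreover have "\<forall>p. \<pi> (\<pi> p) = p" by (simp add: \<pi>_def forall_2)
  ultimately show ?thesis by (rule unitary_monomial_mat) simp
qed

lemma unitary_chain4: "unitary_mat chain4"
proof -
  \<comment> \<open>Unlike the earlier permutations, this one is not an involution and needs its own
    inverse.\<close>
  define \<pi> \<sigma> :: "idx3 \<Rightarrow> idx3" where
    "\<pi> = (\<lambda>(a, b, c). (if b = 1 then a else flip a, b, if a = b then c else flip c))" and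
    "\<sigma> = (\<lambda>(a, b, c). (if b = 1 then a else flip a, b, if a = 1 then c else flip c))"
  have "chain4 = monomial_mat \<pi> (\<lambda>_. 1)"
    by (simp add: chain4_def chain3_def chain2_def chain1_def kron3_def mat_def monomial_mat_def vec_eq_iff
      \<pi>_def forall_2)
  moreover have "\<forall>p. \<sigma> (\<pi> p) = p" by (simp add: \<pi>_def \<sigma>_def forall_2)
  ultimately show ?thesis by (rule unitary_monomial_mat) simp
qed

lemma sum_of_kron3_chain1: "sum_of_kron3 1 chain1"
  using sum_of_kron3_Suc[OF sum_of_kron3_0] by (simp add: chain1_def)

text \<open>The flattening of the first qubit against the other two is injective, whereas three
  terms would leave a kernel.\<close>

lemma chain4_ge:
  assumes "sum_of_kron3 s chain4"
  shows "4 \<le> s"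
proof (rule ccontr)
  assume "\<not> 4 \<le> s"
  then have "sum_of_kron3 3 chain4" using assms sum_of_kron3_mono by simp
  then obtain A B C :: "nat \<Rightarrow> qubit_op" where U: "chain4 = (\<Sum>j<3. kron3 (A j) (B j) (C j))"
    by (auto simp: sum_of_kron3_def)
  obtain X where X: "X \<noteq> 0" "trace (A 0 ** X) = 0" "trace (A 1 ** X) = 0" "trace (A 2 ** X) = 0"
    by (rule common_kernel_3)
  have "trace (chain4 ** kron3 X Y Z) = 0" for Y Z
    unfolding U trace_sum_kron3 using X by (simp add: numeral_3_eq_3 numeral_2_eq_2)
  note this[unfolded chain4_def chain3_def chain2_def chain1_def matrix_mult_add_left trace_add
      kron3_mult trace_kron3]
  \<comment> \<open>The four tests return \<open>X$1$1\<close>, \<open>X$2$2\<close>,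
    \<open>X$1$2\<close> and \<open>X$2$1\<close>, in this order.\<close>
  note vanish = this[of "mat2 1 0 0 0" "mat2 1 0 0 0"] this[of "mat2 1 0 0 0" "mat2 0 1 0 0"]
    this[of "mat2 0 0 0 1" "mat2 1 0 0 0"] this[of "mat2 0 0 0 1" "mat2 0 1 0 0"]
  have "X = 0"
    using vanish by (intro mat2_eqI) (simp_all add: trace_2 matrix_mult_2 mat_def)
  with X show False by simp
qed

subsection \<open>Schmidt ranks five and six\<close>

text \<open>The first qubit selects either the swap of the other two, written as the sum of the
  products of each matrix unit with its transpose, or a flip of the third.\<close>

definition pencil5 :: op3 where
  "pencil5 = kron3 (mat2 1 0 0 0) (mat2 1 0 0 0) (mat2 1 0 0 0)
    + kron3 (mat2 1 0 0 0) (mat2 0 1 0 0) (mat2 0 0 1 0)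
    + kron3 (mat2 1 0 0 0) (mat2 0 0 1 0) (mat2 0 1 0 0)
    + kron3 (mat2 1 0 0 0) (mat2 0 0 0 1) (mat2 0 0 0 1)
    + kron3 (mat2 0 0 0 1) (mat 1) (mat2 0 1 1 0)"

text \<open>Where the first two qubits are both in state 2, the flip becomes
  \<open>mat2 0 1 (-1) 0\<close>.\<close>

definition pencil6 :: op3 where
  "pencil6 = pencil5 + kron3 (mat2 0 0 0 1) (mat2 0 0 0 1) (mat2 0 0 (-2) 0)"

lemma unitary_pencil5: "unitary_mat pencil5"
proof -
  define \<pi> :: "idx3 \<Rightarrow> idx3" where "\<pi> = (\<lambda>(a, b, c). if a = 1 then (a, c, b) else (a, b, flip c))"
  have "pencil5 = monomial_mat \<pi> (\<lambda>_. 1)"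
    by (simp add: pencil5_def kron3_def mat_def monomial_mat_def vec_eq_iff \<pi>_def forall_2)
  moreover have "\<forall>p. \<pi> (\<pi> p) = p" by (simp add: \<pi>_def forall_2)
  ultimately show ?thesis by (rule unitary_monomial_mat) simp
qed

lemma unitary_pencil6: "unitary_mat pencil6"
proof -
  define \<pi> :: "idx3 \<Rightarrow> idx3" where "\<pi> = (\<lambda>(a, b, c). if a = 1 then (a, c, b) else (a, b, flip c))"
  have "pencil6 = monomial_mat \<pi> (\<lambda>p. if p = (2, 2, 2) then -1 else 1)"
    by (simp add: pencil6_def pencil5_def kron3_def mat_def monomial_mat_def vec_eq_iff \<pi>_def forall_2)
  moreover have "\<forall>p. \<pi> (\<pi> p) = p" by (simp add: \<pi>_def forall_2)
  ultimately show ?thesis by (rule unitary_monomial_mat) simp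
qed

lemma sum_of_kron3_pencil5: "sum_of_kron3 5 pencil5"
proof -
  have "sum_of_kron3 (Suc (Suc (Suc (Suc (Suc 0))))) (0 + pencil5)"
    unfolding pencil5_def add.assoc[symmetric] by (intro sum_of_kron3_Suc sum_of_kron3_0)
  then show ?thesis by (simp add: numeral_eq_Suc)
qed

text \<open>The first slice is nondegenerate; the second sees only the diagonal of \<open>Y\<close>
  and the off-diagonal entries of \<open>W\<close>.\<close>

lemma trace_pencil6:
  "trace (pencil6 ** kron3 (mat2 1 0 0 0) Y W) = trace (W ** Y)"
  "trace (pencil6 ** kron3 (mat2 0 0 0 1) Y W) =
     Y$1$1 * (W$1$2 + W$2$1) + Y$2$2 * (W$2$1 - W$1$2)"
  unfolding pencil6_def pencil5_def matrix_mult_add_left trace_add kron3_mult trace_kron3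
  by (simp_all add: trace_2 matrix_mult_2 mat_def algebra_simps)

lemma cramer_2:
  fixes x y z w e f :: complex
  assumes "x * w \<noteq> y * z"
  obtains s t where "x * s + y * t = e" "z * s + w * t = f"
proof
  have nz: "x * w - y * z \<noteq> 0" using assms by simp
  have "(x * (e * w - y * f) + y * (x * f - e * z)) = e * (x * w - y * z)"
    "(z * (e * w - y * f) + w * (x * f - e * z)) = f * (x * w - y * z)"
    by (simp_all add: algebra_simps)
  with nz show "x * ((e * w - y * f) / (x * w - y * z)) + y * ((x * f - e * z) / (x * w - y * z)) = e"
    "z * ((e * w - y * f) / (x * w - y * z)) + w * ((x * f - e * z) / (x * w - y * z)) = f"
    by (simp_all add: add_divide_distrib[symmetric])
qed

text \<open>Substitution method: of five terms, two are removed by adjusting the diagonal of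
  \<open>W\<close>, which the second slice ignores, and three by the choice of
  \<open>Y\<close>.\<close>

lemma pencil6_ge:
  assumes "sum_of_kron3 s pencil6"
  shows "6 \<le> s"
proof (rule ccontr)
  assume "\<not> 6 \<le> s"
  then have "sum_of_kron3 5 pencil6" using assms sum_of_kron3_mono by simp
  then obtain A B C :: "nat \<Rightarrow> qubit_op" where U: "pencil6 = (\<Sum>j<5. kron3 (A j) (B j) (C j))"
    by (auto simp: sum_of_kron3_def)
  have tr: "trace (pencil6 ** kron3 X Y W) =
      (\<Sum>j<5. trace (A j ** X) * trace (B j ** Y) * trace (C j ** W))" for X Y W
    unfolding U trace_sum_kron3 ..
  \<comment> \<open>Otherwise all five functionals \<open>C j\<close> kill a common nonzero diagonal
    matrix, against the nondegeneracy of the first slice.\<close>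
  have "\<exists>j<5. \<exists>k<5. C j $1$1 * C k $2$2 \<noteq> C j $2$2 * C k $1$1"
  proof (rule ccontr)
    assume neg: "\<not> ?thesis"
    obtain d e where de: "d \<noteq> 0 \<or> e \<noteq> 0" "\<And>j. j < 5 \<Longrightarrow> C j $1$1 * d + C j $2$2 * e = 0"
    proof (cases "\<exists>j<5. C j $1$1 \<noteq> 0 \<or> C j $2$2 \<noteq> 0")
      case True
      then obtain k where k: "k < 5" "C k $1$1 \<noteq> 0 \<or> C k $2$2 \<noteq> 0" by blast
      show ?thesis
      proof (rule that)
        show "C k $2$2 \<noteq> 0 \<or> - C k $1$1 \<noteq> 0" using k by auto
        show "C j $1$1 * C k $2$2 + C j $2$2 * - C k $1$1 = 0" if "j < 5" for j
          using neg k that by auto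
      qed
    next
      case False
      then show ?thesis using that[of 1 0] by auto
    qed
    have "trace (pencil6 ** kron3 (mat2 1 0 0 0) Y (mat2 d 0 0 e)) = 0" for Y
      unfolding tr using de(2) by (intro sum.neutral) (auto simp: trace_2 matrix_mult_2)
    from this[of "mat2 1 0 0 0"] this[of "mat2 0 0 0 1"] de(1) show False
      unfolding trace_pencil6 by (simp add: trace_2 matrix_mult_2)
  qed
  then obtain j k where jk: "j < 5" "k < 5" "C j $1$1 * C k $2$2 \<noteq> C j $2$2 * C k $1$1" by blast
  then have "j \<noteq> k" by auto
  with jk have "card ({..<5} - {j, k}) = 3" by simp
  then obtain l m n where lmn: "{..<5} - {j, k} = {l, m, n}" by (auto simp: card_3_iff)
  obtain Y where Y: "Y \<noteq> 0" "trace (B l ** Y) = 0" "trace (B m ** Y) = 0" "trace (B n ** Y) = 0"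
    by (rule common_kernel_3)
  have zero: "trace (pencil6 ** kron3 X Y W) = 0"
    if "trace (C j ** W) = 0" "trace (C k ** W) = 0" for X W
    unfolding tr
  proof (intro sum.neutral ballI)
    fix i :: nat assume "i \<in> {..<5}"
    then have "i \<in> {j, k, l, m, n}" using lmn by blast
    then show "trace (A i ** X) * trace (B i ** Y) * trace (C i ** W) = 0" using that Y by auto
  qed
  \<comment> \<open>The off-diagonal part of \<open>W\<close> is prescribed; its diagonal is solved
    for so that \<open>C j\<close> and \<open>C k\<close> vanish.\<close>
  obtain d e where de: "C j $1$1 * d + C j $2$2 * e = - C j $2$1"
      "C k $1$1 * d + C k $2$2 * e = - C k $2$1"
    using cramer_2[OF jk(3)] by blast
  obtain d' e' where de': "C j $1$1 * d' + C j $2$2 * e' = - C j $1$2"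
      "C k $1$1 * d' + C k $2$2 * e' = - C k $1$2"
    using cramer_2[OF jk(3)] by blast
  have W: "trace (pencil6 ** kron3 X Y (mat2 d 1 0 e)) = 0" for X
    using de by (intro zero) (simp_all add: trace_2 matrix_mult_2 algebra_simps add_eq_0_iff)
  have W': "trace (pencil6 ** kron3 X Y (mat2 d' 0 1 e')) = 0" for X
    using de' by (intro zero) (simp_all add: trace_2 matrix_mult_2 algebra_simps add_eq_0_iff)
  \<comment> \<open>The second slice gives both the difference and the sum of the diagonal entries
    of \<open>Y\<close> as zero.\<close>
  have diag: "Y$1$1 = 0" "Y$2$2 = 0"
    using W[of "mat2 0 0 0 1"] W'[of "mat2 0 0 0 1"] unfolding trace_pencil6 by (simp_all add: add_eq_0_iff)
  then have "Y$2$1 = 0" "Y$1$2 = 0"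
    using W[of "mat2 1 0 0 0"] W'[of "mat2 1 0 0 0"] unfolding trace_pencil6
    by (simp_all add: trace_2 matrix_mult_2)
  with diag have "Y = 0" by (intro mat2_eqI) simp_all
  with Y show False by simp
qed

subsection \<open>The rank of two-by-two matrix multiplication\<close>

definition matmul_decomp ::
  "'j set \<Rightarrow> ('j \<Rightarrow> qubit_op) \<Rightarrow> ('j \<Rightarrow> qubit_op) \<Rightarrow> ('j \<Rightarrow> qubit_op) \<Rightarrow> bool" where
  "matmul_decomp J A B C \<longleftrightarrow> (\<forall>X Y Z. trace (X ** Y ** Z) =
     (\<Sum>j\<in>J. trace (A j ** X) * trace (B j ** Y) * trace (C j ** Z)))"

abbreviation active :: "'j set \<Rightarrow> ('j \<Rightarrow> qubit_op) \<Rightarrow> qubit_op \<Rightarrow> 'j set" where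
  "active J A X \<equiv> {j \<in> J. trace (A j ** X) \<noteq> 0}"

text \<open>Replacing \<open>X\<close>, \<open>Y\<close>, \<open>Z\<close> by
  \<open>S' ** X ** T'\<close>, \<open>T ** Y\<close>, \<open>Z ** S\<close> preserves the trace of
  the product; the functionals absorb the change.\<close>

lemma matmul_decomp_sandwich:
  assumes "matmul_decomp J A B C" "S ** S' = mat 1" "T' ** T = mat 1"
  shows "matmul_decomp J (\<lambda>j. T' ** A j ** S') (\<lambda>j. B j ** T) (\<lambda>j. S ** C j)"
  unfolding matmul_decomp_def
proof (intro allI)
  fix X Y Z :: qubit_op
  have "trace (X ** Y ** Z) = trace (S ** S' ** (X ** (T' ** T) ** Y ** Z))"
    by (simp add: assms)
  also have "\<dots> = trace (S ** (S' ** X ** T' ** (T ** Y) ** Z))"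
    by (simp add: matrix_mul_assoc)
  also have "\<dots> = trace ((S' ** X ** T') ** (T ** Y) ** (Z ** S))"
    by (subst trace_mul_sym) (simp add: matrix_mul_assoc)
  also have "\<dots> = (\<Sum>j\<in>J. trace (A j ** (S' ** X ** T')) * trace (B j ** (T ** Y)) * trace (C j ** (Z ** S)))"
    using assms(1) by (simp add: matmul_decomp_def)
  also have "\<dots> = (\<Sum>j\<in>J. trace (T' ** A j ** S' ** X) * trace (B j ** T ** Y) * trace (S ** C j ** Z))"
  proof (intro sum.cong refl)
    fix j
    have "trace (A j ** (S' ** X ** T')) = trace (T' ** A j ** S' ** X)"
      using trace_mul_sym[of T' "A j ** S' ** X"] by (simp add: matrix_mul_assoc)
    moreover have "trace (C j ** (Z ** S)) = trace (S ** C j ** Z)"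
      using trace_mul_sym[of S "C j ** Z"] by (simp add: matrix_mul_assoc)
    ultimately show "trace (A j ** (S' ** X ** T')) * trace (B j ** (T ** Y)) * trace (C j ** (Z ** S))
        = trace (T' ** A j ** S' ** X) * trace (B j ** T ** Y) * trace (S ** C j ** Z)"
      by (simp add: matrix_mul_assoc)
  qed
  finally show "trace (X ** Y ** Z) =
      (\<Sum>j\<in>J. trace (T' ** A j ** S' ** X) * trace (B j ** T ** Y) * trace (S ** C j ** Z))" .
qed

text \<open>Lets singular first arguments be moved to matrix units.\<close>

lemma matmul_decomp_change_basis:
  assumes "matmul_decomp J A B C" "det P \<noteq> 0" "det Q \<noteq> 0"
  obtains A' B' C' where "matmul_decomp J A' B' C'"
    "\<And>j X. trace (A' j ** X) = trace (A j ** (P ** X ** Q))"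
proof -
  obtain P' Q' where "P' ** P = mat 1" "Q ** Q' = mat 1"
    using assms(2,3) unfolding invertible_det_nz[symmetric] invertible_def by blast
  note decomp = matmul_decomp_sandwich[OF assms(1) this]
  have "trace (Q ** A j ** P ** X) = trace (A j ** (P ** X ** Q))" for j X
    using trace_mul_sym[of Q "A j ** P ** X"] by (simp add: matrix_mul_assoc)
  with decomp show ?thesis by (rule that)
qed

section \<open>How many terms stay active at a given first argument\<close>

lemma trace_mult_eq_0_D:
  fixes X :: qubit_op
  assumes "\<And>Y. trace (X ** Y) = 0"
  shows "X = 0"
  using assms[of "mat2 1 0 0 0"] assms[of "mat2 0 1 0 0"] assms[of "mat2 0 0 1 0"] assms[of "mat2 0 0 0 1"]
  by (intro mat2_eqI) (simp_all add: trace_2 matrix_mult_2)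

lemma card_le_3_subset:
  assumes "finite N" "card N \<le> 3"
  obtains a b c where "N \<subseteq> {a, b, c}"
proof -
  have "\<exists>a b c. N \<subseteq> {a, b, c}"
  proof (cases "card N = 3")
    case True
    then show ?thesis by (auto simp: card_3_iff)
  next
    case False
    with assms(2) consider "card N = 0" | "card N = 1" | "card N = 2" by linarith
    then show ?thesis
    proof cases
      case 1
      then show ?thesis using assms(1) by simp
    next
      case 2
      then show ?thesis by (auto simp: card_1_singleton_iff)
    next
      case 3
      then show ?thesis by (auto simp: card_2_iff)
    qed
  qed
  then show ?thesis using that by blast
qed

text \<open>A single \<open>Y\<close> killed by the functionals \<open>B\<close> indexed by
  \<open>N\<close> serves every \<open>X\<close> whose active terms lie in \<open>N\<close>.\<close>

lemma right_annihilator: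
  assumes "matmul_decomp J A B C" "finite N" "card N \<le> 3"
  shows "\<exists>Y :: qubit_op. Y \<noteq> 0 \<and> (\<forall>X. active J A X \<subseteq> N \<longrightarrow> X ** Y = 0)"
proof -
  obtain a b c where N: "N \<subseteq> {a, b, c}" using card_le_3_subset assms(2,3) .
  obtain Y where Y: "Y \<noteq> 0" "trace (B a ** Y) = 0" "trace (B b ** Y) = 0" "trace (B c ** Y) = 0"
    by (rule common_kernel_3)
  have "X ** Y = 0" if "active J A X \<subseteq> N" for X
  proof (rule trace_mult_eq_0_D)
    fix Z
    show "trace (X ** Y ** Z) = 0"
      unfolding assms(1)[unfolded matmul_decomp_def, rule_format] using N Y that
      by (intro sum.neutral) fastforce
  qed
  with Y(1) show ?thesis by auto
qed

text \<open>The mirror image on the side of \<open>C\<close>: cyclicity of the trace moves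
  \<open>Z\<close> to the left of \<open>X\<close>.\<close>

lemma left_annihilator:
  assumes "matmul_decomp J A B C" "finite N" "card N \<le> 3"
  shows "\<exists>Z :: qubit_op. Z \<noteq> 0 \<and> (\<forall>X. active J A X \<subseteq> N \<longrightarrow> Z ** X = 0)"
proof -
  obtain a b c where N: "N \<subseteq> {a, b, c}" using card_le_3_subset assms(2,3) .
  obtain Z where Z: "Z \<noteq> 0" "trace (C a ** Z) = 0" "trace (C b ** Z) = 0" "trace (C c ** Z) = 0"
    by (rule common_kernel_3)
  have "Z ** X = 0" if "active J A X \<subseteq> N" for X
  proof (rule trace_mult_eq_0_D)
    fix Y
    have "trace (Z ** X ** Y) = trace (X ** Y ** Z)"
      using trace_mul_sym[of Z "X ** Y"] by (simp add: matrix_mul_assoc)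
    also have "\<dots> = 0"
      unfolding assms(1)[unfolded matmul_decomp_def, rule_format] using N Z that
      by (intro sum.neutral) fastforce
    finally show "trace (Z ** X ** Y) = 0" .
  qed
  with Z(1) show ?thesis by auto
qed

lemma det_eq_0_if_few_active:
  assumes "matmul_decomp J A B C" "finite N" "card N \<le> 3" "active J A X \<subseteq> N"
  shows "det X = 0"
proof (rule ccontr)
  assume "det X \<noteq> 0"
  then obtain X' where "X' ** X = mat 1"
    unfolding invertible_det_nz[symmetric] invertible_def by blast
  moreover obtain Y :: qubit_op where Y: "Y \<noteq> 0" "X ** Y = 0"
    using right_annihilator[OF assms(1-3)] assms(4) by blast
  ultimately have "Y = X' ** X ** Y" by simp
  with Y show False by (simp flip: matrix_mul_assoc)
qed

text \<open>With at most one active term, the bilinear form in \<open>Y\<close> and \<open>Z\<close>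
  would have rank at most one, but on suitable matrix units it is a nonzero multiple of the 2 by 2
  identity.\<close>

lemma active_card_ge_2:
  assumes dec: "matmul_decomp J A B C" and J: "finite J" and X: "X \<noteq> 0"
  shows "2 \<le> card (active J A X)"
proof (rule ccontr)
  assume "\<not> ?thesis"
  then have "card (active J A X) \<le> 1" by simp
  then obtain s where s: "active J A X \<subseteq> {s}"
    using J by (cases "active J A X = {}") (auto simp: card_le_Suc0_iff_eq)
  \<comment> \<open>If no term is active, \<open>s\<close> is arbitrary and may lie outside
    \<open>J\<close>; the weight 0 covers this.\<close>
  define w where "w = (if s \<in> J then trace (A s ** X) else 0)"
  have tr: "trace (X ** Y ** Z) = w * trace (B s ** Y) * trace (C s ** Z)" for Y Z
  proof -
    have "trace (X ** Y ** Z) = (\<Sum>j\<in>J. if j = s then w * trace (B s ** Y) * trace (C s ** Z) else 0)"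
      unfolding dec[unfolded matmul_decomp_def, rule_format] using s
      by (intro sum.cong) (auto simp: w_def)
    then show ?thesis using J by (auto simp: w_def)
  qed
  obtain a b where ab: "X $ a $ b \<noteq> 0" using X by (auto simp: vec_eq_iff)
  define E :: "2 \<Rightarrow> 2 \<Rightarrow> qubit_op" where "E i j = (\<chi> k l. if k = i \<and> l = j then 1 else 0)" for i j
  have "trace (X ** E b c ** E d a) = (if c = d then X $ a $ b else 0)" for c d
  proof -
    have "\<forall>a b c d. trace (X ** E b c ** E d a) = (if c = d then X $ a $ b else 0)"
      by (simp add: forall_2 E_def trace_2 matrix_mult_2)
    then show ?thesis by blast
  qed
  then have E: "w * trace (B s ** E b c) * trace (C s ** E d a) = (if c = d then X $ a $ b else 0)" for c d
    by (simp add: tr)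
  show False
    using E[of 1 1] E[of 1 2] E[of 2 2] ab by auto
qed

section \<open>Nondegenerate two-term bilinear forms\<close>

lemma dual_pair_kernel:
  fixes x1 x2 y1 y2 z1 z2 w1 w2 e1 e2 :: complex
  assumes "x1 * y1 + x2 * y2 = 1" "x1 * z1 + x2 * z2 = 0" "w1 * y1 + w2 * y2 = 0" "w1 * z1 + w2 * z2 = 1"
    and "e1 * y1 + e2 * y2 = 0" "e1 * z1 + e2 * z2 = 0"
  shows "e1 = 0 \<and> e2 = 0"
proof -
  \<comment> \<open>The two factors are, up to transposition, determinants of mutually inverse
    matrices.\<close>
  have "(x1 * w2 - x2 * w1) * (y1 * z2 - y2 * z1) = 1"
    using assms(1-4) by algebra
  then have nz: "y1 * z2 - y2 * z1 \<noteq> 0" by auto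
  have "e1 * (y1 * z2 - y2 * z1) = 0" "e2 * (y1 * z2 - y2 * z1) = 0"
    using assms(5,6) by algebra+
  with nz show ?thesis by auto
qed

lemma dual_pair_kernel_middle:
  fixes a1 a2 x1 x2 y1 y2 z1 z2 w1 w2 e1 e2 :: complex
  assumes "a1 * x1 * y1 + a2 * x2 * y2 = 1" "a1 * x1 * z1 + a2 * x2 * z2 = 0"
    and "a1 * w1 * y1 + a2 * w2 * y2 = 0" "a1 * w1 * z1 + a2 * w2 * z2 = 1"
    and "a1 * e1 * y1 + a2 * e2 * y2 = 0" "a1 * e1 * z1 + a2 * e2 * z2 = 0"
  shows "e1 = 0 \<and> e2 = 0"
  by (rule dual_pair_kernel[of x1 "a1 * y1" x2 "a2 * y2" "a1 * z1" "a2 * z2" w1 w2])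
    (use assms in \<open>simp_all add: ac_simps\<close>)

text \<open>Now the weights are the unknowns: they vanish because in each coordinate
  \<open>x\<close> or \<open>w\<close> is nonzero.\<close>

lemma dual_pair_kernel_left:
  fixes a1 a2 x1 x2 y1 y2 z1 z2 w1 w2 e1 e2 :: complex
  assumes "a1 * x1 * y1 + a2 * x2 * y2 = 1" "a1 * x1 * z1 + a2 * x2 * z2 = 0"
    and "a1 * w1 * y1 + a2 * w2 * y2 = 0" "a1 * w1 * z1 + a2 * w2 * z2 = 1"
    and "e1 * x1 * y1 + e2 * x2 * y2 = 0" "e1 * x1 * z1 + e2 * x2 * z2 = 0"
    and "e1 * w1 * y1 + e2 * w2 * y2 = 0" "e1 * w1 * z1 + e2 * w2 * z2 = 0"
  shows "e1 = 0 \<and> e2 = 0"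
proof -
  have "e1 * x1 = 0 \<and> e2 * x2 = 0"
    by (rule dual_pair_kernel[OF assms(1-6)])
  moreover have "e1 * w1 = 0 \<and> e2 * w2 = 0"
    by (rule dual_pair_kernel[OF assms(1-4,7-8)])
  moreover have "x1 \<noteq> 0 \<or> w1 \<noteq> 0" "x2 \<noteq> 0 \<or> w2 \<noteq> 0"
    using assms(1-4) by auto
  ultimately show ?thesis by auto
qed

text \<open>At the first matrix unit the form is the first row of \<open>Y\<close> times the first
  column of \<open>Z\<close>, carried by \<open>m\<close> and \<open>n\<close> alone, so their
  functionals see nothing else; likewise \<open>k\<close> and \<open>l\<close> at the last one.
  Suitable rows and columns then isolate the terms \<open>i\<close> and \<open>j\<close>.\<close>

lemma no_diagonal_split:
  assumes dec: "matmul_decomp {i, j, k, l, m, n} A B C" and dist: "distinct [i, j, k, l, m, n]"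
    and act1: "active {i, j, k, l, m, n} A (mat2 1 0 0 0) \<subseteq> {m, n}"
    and act2: "active {i, j, k, l, m, n} A (mat2 0 0 0 1) \<subseteq> {k, l}"
  shows False
proof -
  define \<alpha> \<beta> \<gamma> where "\<alpha> s X = trace (A s ** X)" and "\<beta> s X = trace (B s ** X)"
    and "\<gamma> s X = trace (C s ** X)" for s X
  let ?E = "mat2 1 0 0 0 :: qubit_op" and ?F = "mat2 0 1 0 0 :: qubit_op"
    and ?G = "mat2 0 0 1 0 :: qubit_op" and ?H = "mat2 0 0 0 1 :: qubit_op"
  have tr: "trace (X ** Y ** Z) = \<alpha> i X * \<beta> i Y * \<gamma> i Z + \<alpha> j X * \<beta> j Y * \<gamma> j Z + \<alpha> k X * \<beta> k Y * \<gamma> k Z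
      + \<alpha> l X * \<beta> l Y * \<gamma> l Z + \<alpha> m X * \<beta> m Y * \<gamma> m Z + \<alpha> n X * \<beta> n Y * \<gamma> n Z" for X Y Z
    using dec dist by (simp add: matmul_decomp_def \<alpha>_def \<beta>_def \<gamma>_def)
  have E0: "\<alpha> i ?E = 0" "\<alpha> j ?E = 0" "\<alpha> k ?E = 0" "\<alpha> l ?E = 0"
    using act1 dist by (auto simp: \<alpha>_def)
  have H0: "\<alpha> i ?H = 0" "\<alpha> j ?H = 0" "\<alpha> m ?H = 0" "\<alpha> n ?H = 0"
    using act2 dist by (auto simp: \<alpha>_def)
  have trE: "\<alpha> m ?E * \<beta> m Y * \<gamma> m Z + \<alpha> n ?E * \<beta> n Y * \<gamma> n Z = Y$1$1 * Z$1$1 + Y$1$2 * Z$2$1" for Y Z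
    using tr[of ?E Y Z] E0 by (simp add: trace_2 matrix_mult_2)
  have trH: "\<alpha> k ?H * \<beta> k Y * \<gamma> k Z + \<alpha> l ?H * \<beta> l Y * \<gamma> l Z = Y$2$1 * Z$1$2 + Y$2$2 * Z$2$2" for Y Z
    using tr[of ?H Y Z] H0 by (simp add: trace_2 matrix_mult_2)
  \<comment> \<open>The roles of \<beta> and \<gamma> are exchanged, so that the same kernel lemma
    applies to \<gamma>.\<close>
  note trE' = trE[unfolded mult.assoc mult.commute[of "\<beta> _ _"], folded mult.assoc]
    and trH' = trH[unfolded mult.assoc mult.commute[of "\<beta> _ _"], folded mult.assoc]
  have \<beta>mn: "\<beta> m Y = 0 \<and> \<beta> n Y = 0" if "Y$1$1 = 0" "Y$1$2 = 0" for Y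
    by (rule dual_pair_kernel_middle[of "\<alpha> m ?E" "\<beta> m ?E" "\<gamma> m ?E" "\<alpha> n ?E" "\<beta> n ?E" "\<gamma> n ?E"
        "\<gamma> m ?G" "\<gamma> n ?G" "\<beta> m ?F" "\<beta> n ?F"]) (simp_all add: trE that)
  have \<gamma>mn: "\<gamma> m Z = 0 \<and> \<gamma> n Z = 0" if "Z$1$1 = 0" "Z$2$1 = 0" for Z
    by (rule dual_pair_kernel_middle[of "\<alpha> m ?E" "\<gamma> m ?E" "\<beta> m ?E" "\<alpha> n ?E" "\<gamma> n ?E" "\<beta> n ?E"
        "\<beta> m ?F" "\<beta> n ?F" "\<gamma> m ?G" "\<gamma> n ?G"])
      (simp_all add: trE' that)
  have \<beta>kl: "\<beta> k Y = 0 \<and> \<beta> l Y = 0" if "Y$2$1 = 0" "Y$2$2 = 0" for Y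
    by (rule dual_pair_kernel_middle[of "\<alpha> k ?H" "\<beta> k ?G" "\<gamma> k ?F" "\<alpha> l ?H" "\<beta> l ?G" "\<gamma> l ?F"
        "\<gamma> k ?H" "\<gamma> l ?H" "\<beta> k ?H" "\<beta> l ?H"]) (simp_all add: trH that)
  have \<gamma>kl: "\<gamma> k Z = 0 \<and> \<gamma> l Z = 0" if "Z$1$2 = 0" "Z$2$2 = 0" for Z
    by (rule dual_pair_kernel_middle[of "\<alpha> k ?H" "\<gamma> k ?F" "\<beta> k ?G" "\<alpha> l ?H" "\<gamma> l ?F" "\<beta> l ?G"
        "\<beta> k ?H" "\<beta> l ?H" "\<gamma> k ?H" "\<gamma> l ?H"])
      (simp_all add: trH' that)
  have upper: "\<alpha> i X * \<beta> i Y * \<gamma> i Z + \<alpha> j X * \<beta> j Y * \<gamma> j Z = trace (X ** Y ** Z)"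
    if "Y$2$1 = 0" "Y$2$2 = 0" "Z$1$1 = 0" "Z$2$1 = 0" for X Y Z
    using tr[of X Y Z] \<beta>kl[of Y] \<gamma>mn[of Z] that by simp
  have lower: "\<alpha> i X * \<beta> i Y * \<gamma> i Z + \<alpha> j X * \<beta> j Y * \<gamma> j Z = trace (X ** Y ** Z)"
    if "Y$1$1 = 0" "Y$1$2 = 0" "Z$1$2 = 0" "Z$2$2 = 0" for X Y Z
    using tr[of X Y Z] \<beta>mn[of Y] \<gamma>kl[of Z] that by simp
  \<comment> \<open>The isolated form is \<open>X$2$1\<close> times a rank-two form in
    \<open>Y\<close> and \<open>Z\<close>: nondegenerate at \<open>?G\<close>, zero at
    \<open>?F\<close>.\<close>
  have "\<alpha> i ?F = 0 \<and> \<alpha> j ?F = 0"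
    by (rule dual_pair_kernel_left[of "\<alpha> i ?G" "\<beta> i ?E" "\<gamma> i ?F" "\<alpha> j ?G" "\<beta> j ?E" "\<gamma> j ?F"
        "\<gamma> i ?H" "\<gamma> j ?H" "\<beta> i ?F" "\<beta> j ?F"])
      (simp_all add: upper trace_2 matrix_mult_2)
  \<comment> \<open>The instances are \<open>Y\<close>, \<open>Z\<close>, \<open>X\<close> in this
    order; the trace of \<open>?F ** ?G ** ?E\<close> is 1.\<close>
  with lower[of ?G ?E ?F] show False by (simp add: trace_2 matrix_mult_2)
qed

text \<open>Moving from \<open>M\<close> along the first matrix unit keeps \<open>i\<close> and
  \<open>j\<close> inactive and reaches a singular matrix at which all of \<open>S\<close> is
  inactive too, which is the configuration of \<open>no_diagonal_split\<close>.\<close>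

lemma no_invertible_in_pair_kernel:
  assumes dec: "matmul_decomp J A B C" and J: "card J = 6"
    and ijk: "i \<in> J" "j \<in> J" "k \<in> J" "i \<noteq> j" "i \<noteq> k" "j \<noteq> k"
    and E0: "trace (A i ** mat2 1 0 0 0) = 0" "trace (A j ** mat2 1 0 0 0) = 0"
      "trace (A k ** mat2 1 0 0 0) = 0"
    and M: "det M \<noteq> 0" "trace (A i ** M) = 0" "trace (A j ** M) = 0"
  shows False
proof -
  let ?E = "mat2 1 0 0 0 :: qubit_op" and ?H = "mat2 0 0 0 1 :: qubit_op"
  have fin: "finite J" using J by (simp add: card_ge_0_finite)
  define S where "S = active J A ?E"
  have S: "S \<subseteq> J - {i, j, k}" using E0 by (auto simp: S_def)
  have "?E \<noteq> 0" by (metis mat2_nth(1) zero_index zero_neq_one)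
  then have cardS: "2 \<le> card S" unfolding S_def by (rule active_card_ge_2[OF dec fin])
  define q where "q t = mat2 (M$1$1 - t) (M$1$2) (M$2$1) (M$2$2)" for t
  have trq: "trace (A s ** q t) = trace (A s ** M) - t * trace (A s ** ?E)" for s t
    by (simp add: q_def trace_2 matrix_mult_2 algebra_simps)
  have detq: "det (q t) = det M - t * M$2$2" for t
    by (simp add: q_def det_2 algebra_simps)
  \<comment> \<open>Choosing \<open>t\<close> to silence \<open>s\<close> leaves at most three
    active terms, so \<open>q t\<close> is singular. The determinant is affine in \<open>t\<close>,
    hence \<open>t\<close> is the same for all \<open>s\<close> in \<open>S\<close>.\<close>
  have ratio: "det M = trace (A s ** M) / trace (A s ** ?E) * M$2$2" if s: "s \<in> S" for s
  proof -
    let ?t = "trace (A s ** M) / trace (A s ** ?E)"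
    have "trace (A s ** ?E) \<noteq> 0" "s \<in> J" "s \<noteq> i" "s \<noteq> j" using s S by (auto simp: S_def)
    then have "active J A (q ?t) \<subseteq> J - {i, j, s}" "card (J - {i, j, s}) \<le> 3"
      using E0 M ijk J by (auto simp: trq card_Diff_subset)
    then have "det (q ?t) = 0"
      using det_eq_0_if_few_active[OF dec] fin by blast
    then show ?thesis by (simp add: detq)
  qed
  obtain s where "s \<in> S" using cardS by fastforce
  then have d: "M$2$2 \<noteq> 0" using ratio[of s] M(1) by auto
  define t where "t = det M / M$2$2"
  have "active J A (q t) \<subseteq> J - {i, j} - S"
  proof -
    have "trace (A s ** q t) = 0" if "s \<in> S" for s
      using ratio[OF that] that d by (simp add: trq t_def S_def)
    then show ?thesis using E0 M by (auto simp: trq)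
  qed
  have "q t \<noteq> 0" using d by (metis mat2_nth(4) q_def zero_index)
  then have "2 \<le> card (active J A (q t))" by (rule active_card_ge_2[OF dec fin])
  also have "\<dots> \<le> card (J - {i, j} - S)"
    using fin by (intro card_mono \<open>active J A (q t) \<subseteq> J - {i, j} - S\<close>) auto
  finally have cardR: "2 \<le> card (J - {i, j} - S)" .
  \<comment> \<open>Two disjoint sets with at least two elements each share these four indices, so
    both have exactly two.\<close>
  have "card (J - {i, j} - S) + card S = 4"
  proof -
    have "finite S" "S \<subseteq> J - {i, j}" using S fin finite_subset by auto
    moreover have "card (J - {i, j}) = 4" using J ijk by (simp add: card_Diff_subset)
    ultimately show ?thesis
      by (metis card_Diff_subset card_mono fin finite_Diff le_add_diff_inverse2)
  qed
  with cardR cardS have "card (J - {i, j} - S) = 2" "card S = 2" by auto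
  then obtain r l m n where R: "J - {i, j} - S = {r, l}" "r \<noteq> l" and mn: "S = {m, n}" "m \<noteq> n"
    unfolding card_2_iff by blast
  have Jeq: "J = {i, j, r, l, m, n}" using R mn S ijk by blast
  have dist: "distinct [i, j, r, l, m, n]"
  proof -
    have "{r, l} \<inter> {i, j} = {}" "{r, l} \<inter> {m, n} = {}" using R(1) mn(1) by blast+
    moreover have "{m, n} \<inter> {i, j} = {}" using S mn(1) by blast
    ultimately show ?thesis using R(2) mn(2) ijk(4) by auto
  qed
  \<comment> \<open>These matrices fix the first matrix unit and take the last one to the rank-one
    matrix \<open>q t\<close> divided by \<open>M$2$2\<close>.\<close>
  let ?P = "mat2 1 (M$1$2 / M$2$2) 0 1" and ?Q = "mat2 1 0 (M$2$1 / M$2$2) 1"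
  obtain A' B' C' where dec': "matmul_decomp J A' B' C'"
    and A': "\<And>s X. trace (A' s ** X) = trace (A s ** (?P ** X ** ?Q))"
    by (rule matmul_decomp_change_basis[OF dec, of ?P ?Q]) (auto simp: det_2)
  have "?P ** ?E ** ?Q = ?E" by (rule mat2_eqI) (simp_all add: matrix_mult_2)
  then have act1: "active J A' ?E \<subseteq> {m, n}" using mn by (auto simp: A' S_def)
  have "trace (A s ** (?P ** ?H ** ?Q)) = trace (A s ** q t) / M$2$2" for s
    using d by (simp add: trace_2 matrix_mult_2 q_def t_def det_2 field_simps)
  then have "active J A' ?H \<subseteq> {r, l}"
    using \<open>active J A (q t) \<subseteq> J - {i, j} - S\<close> R by (auto simp: A')
  with dec' act1 dist show False unfolding Jeq by (intro no_diagonal_split)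
qed

text \<open>The common kernel also contains some nonzero \<open>X\<close> with
  \<open>X$1$1 = 0\<close>; the cases follow its remaining entries.\<close>

lemma pair_kernel_cases:
  fixes A B :: qubit_op
  assumes "trace (A ** mat2 1 0 0 0) = 0" "trace (B ** mat2 1 0 0 0) = 0"
  obtains M where "det M \<noteq> 0" "trace (A ** M) = 0" "trace (B ** M) = 0"
  | "trace (A ** mat2 0 1 0 0) = 0" "trace (B ** mat2 0 1 0 0) = 0"
  | "trace (A ** mat2 0 0 1 0) = 0" "trace (B ** mat2 0 0 1 0) = 0"
proof -
  obtain X where X: "X \<noteq> 0" "trace (A ** X) = 0" "trace (B ** X) = 0" "trace (mat2 1 0 0 0 ** X) = 0"
    by (rule common_kernel_3)
  have X11: "X$1$1 = 0" using X(4) by (simp add: trace_2 matrix_mult_2)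
  have AB: "A$1$1 = 0" "B$1$1 = 0" using assms by (simp_all add: trace_2 matrix_mult_2)
  show thesis
  proof (cases "X$2$2 = 0")
    case False
    \<comment> \<open>Both functionals ignore the upper left entry, which is chosen to make the
      determinant 1.\<close>
    let ?M = "mat2 ((1 + X$1$2 * X$2$1) / X$2$2) (X$1$2) (X$2$1) (X$2$2)"
    have "det ?M \<noteq> 0" "trace (A ** ?M) = 0" "trace (B ** ?M) = 0"
      using X(2,3) X11 AB False by (simp_all add: det_2 trace_2 matrix_mult_2)
    then show thesis by (rule that(1))
  next
    case True
    consider "X$1$2 \<noteq> 0" "X$2$1 \<noteq> 0" | "X$1$2 \<noteq> 0" "X$2$1 = 0" | "X$1$2 = 0" "X$2$1 \<noteq> 0"
      using X(1) X11 True by (auto simp: vec_eq_iff forall_2)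
    then show thesis
    proof cases
      case 1
      then show thesis using that(1)[of X] X True by (simp add: det_2)
    next
      case 2
      then show thesis using that(2) X X11 True by (simp add: trace_2 matrix_mult_2)
    next
      case 3
      then show thesis using that(3) X X11 True by (simp add: trace_2 matrix_mult_2)
    qed
  qed
qed

text \<open>Each pair among the three functionals kills \<open>?F\<close> or \<open>?G\<close>. Two
  of the three pairs agree on which, and together they cover all three functionals.\<close>

lemma no_triple_kernel_E11:
  assumes dec: "matmul_decomp J A B C" and J: "card J = 6"
    and ijk: "i \<in> J" "j \<in> J" "k \<in> J" "i \<noteq> j" "i \<noteq> k" "j \<noteq> k"
    and E0: "trace (A i ** mat2 1 0 0 0) = 0" "trace (A j ** mat2 1 0 0 0) = 0"
      "trace (A k ** mat2 1 0 0 0) = 0"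
  shows False
proof -
  let ?E = "mat2 1 0 0 0 :: qubit_op" and ?F = "mat2 0 1 0 0 :: qubit_op"
    and ?G = "mat2 0 0 1 0 :: qubit_op"
  let ?kills = "\<lambda>X. trace (A i ** X) = 0 \<and> trace (A j ** X) = 0 \<and> trace (A k ** X) = 0"
  have N: "finite (J - {i, j, k})" "card (J - {i, j, k}) \<le> 3"
    using J ijk by (auto simp: card_Diff_subset intro: card_ge_0_finite)
  have act: "active J A X \<subseteq> J - {i, j, k}" if "?kills X" for X using that by auto
  have F: "\<not> ?kills ?F"
  proof
    assume "?kills ?F"
    obtain Y :: qubit_op where Y: "Y \<noteq> 0" "\<forall>X. active J A X \<subseteq> J - {i, j, k} \<longrightarrow> X ** Y = 0"
      using right_annihilator[OF dec N] by blast
    have EF: "?E ** Y = 0" "?F ** Y = 0"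
      using Y(2)[rule_format, OF act] E0 \<open>?kills ?F\<close> by simp_all
    \<comment> \<open>The products with \<open>?E\<close> and \<open>?F\<close> read off both rows
      of \<open>Y\<close>.\<close>
    have "Y$1$c = (?E ** Y)$1$c" "Y$2$c = (?F ** Y)$1$c" for c
      by (simp_all add: matrix_mult_2)
    with Y(1) show False by (simp add: EF vec_eq_iff forall_2)
  qed
  have G: "\<not> ?kills ?G"
  proof
    assume "?kills ?G"
    obtain Z :: qubit_op where Z: "Z \<noteq> 0" "\<forall>X. active J A X \<subseteq> J - {i, j, k} \<longrightarrow> Z ** X = 0"
      using left_annihilator[OF dec N] by blast
    have EG: "Z ** ?E = 0" "Z ** ?G = 0"
      using Z(2)[rule_format, OF act] E0 \<open>?kills ?G\<close> by simp_all
    have "Z$c$1 = (Z ** ?E)$c$1" "Z$c$2 = (Z ** ?G)$c$1" for c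
      by (simp_all add: matrix_mult_2)
    with Z(1) show False by (simp add: EG vec_eq_iff forall_2)
  qed
  have pair: "trace (A a ** ?F) = 0 \<and> trace (A b ** ?F) = 0 \<or> trace (A a ** ?G) = 0 \<and> trace (A b ** ?G) = 0"
    if "{a, b, c} = {i, j, k}" "a \<noteq> b" "a \<noteq> c" "b \<noteq> c" for a b c
  proof -
    have "\<forall>s\<in>{a, b, c}. s \<in> J \<and> trace (A s ** ?E) = 0"
      unfolding that(1) using ijk E0 by simp
    then have abc: "a \<in> J" "b \<in> J" "c \<in> J"
      "trace (A a ** ?E) = 0" "trace (A b ** ?E) = 0" "trace (A c ** ?E) = 0"
      by simp_all
    show ?thesis
    proof (rule pair_kernel_cases[OF abc(4,5)])
      fix M assume "det M \<noteq> 0" "trace (A a ** M) = 0" "trace (A b ** M) = 0"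
      then show ?thesis using no_invertible_in_pair_kernel[OF dec J abc(1-3) that(2-4) abc(4-6)] by blast
    qed blast+
  qed
  show False
    using pair[of i j k] pair[of i k j] pair[of j k i] F G ijk by (auto simp: insert_commute)
qed

text \<open>The product is the first column of \<open>P\<close> times the first row of
  \<open>Q\<close>; the other entries only secure invertibility.\<close>

lemma rank_one_normal_form:
  fixes p :: qubit_op
  assumes "p \<noteq> 0" "det p = 0"
  obtains P Q where "det P \<noteq> 0" "det Q \<noteq> 0" "P ** mat2 1 0 0 0 ** Q = p"
proof -
  have det: "p$1$1 * p$2$2 = p$1$2 * p$2$1" using assms(2) by (simp add: det_2)
  consider "p$1$1 \<noteq> 0" | "p$1$2 \<noteq> 0" | "p$2$1 \<noteq> 0" | "p$2$2 \<noteq> 0"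
    using assms(1) by (auto simp: vec_eq_iff forall_2)
  then show thesis
  proof cases
    case 1
    then show thesis using det
      by (intro that[of "mat2 (p$1$1) 0 (p$2$1) 1" "mat2 1 (p$1$2 / p$1$1) 0 1"] mat2_eqI)
        (simp_all add: det_2 matrix_mult_2 field_simps)
  next
    case 2
    then show thesis using det
      by (intro that[of "mat2 (p$1$2) 0 (p$2$2) 1" "mat2 (p$1$1 / p$1$2) 1 1 0"] mat2_eqI)
        (simp_all add: det_2 matrix_mult_2 field_simps)
  next
    case 3
    then show thesis using det
      by (intro that[of "mat2 (p$1$1 / p$2$1) 1 1 0" "mat2 (p$2$1) (p$2$2) 0 1"] mat2_eqI)
        (simp_all add: det_2 matrix_mult_2 field_simps)
  next
    case 4
    then show thesis using det
      by (intro that[of "mat2 (p$1$2 / p$2$2) 1 1 0" "mat2 (p$2$1) (p$2$2) 1 0"] mat2_eqI)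
        (simp_all add: det_2 matrix_mult_2 field_simps)
  qed
qed

text \<open>A common zero of any three functionals leaves at most three active terms, so it is
  singular and can be moved to the first matrix unit.\<close>

lemma no_matmul_decomp_6:
  assumes dec: "matmul_decomp J A B C"
  shows "card J \<noteq> 6"
proof
  assume J: "card J = 6"
  then obtain I where I: "I \<subseteq> J" "card I = 3" using obtain_subset_with_card_n[of 3 J] by auto
  then obtain i j k where ijk: "I = {i, j, k}" "i \<noteq> j" "i \<noteq> k" "j \<noteq> k" by (auto simp: card_3_iff)
  obtain p where p: "p \<noteq> 0" "trace (A i ** p) = 0" "trace (A j ** p) = 0" "trace (A k ** p) = 0"
    by (rule common_kernel_3)
  have "det p = 0"
  proof (rule det_eq_0_if_few_active[OF dec])
    show "finite (J - I)" "card (J - I) \<le> 3"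
      using I J by (auto simp: card_Diff_subset card_ge_0_finite intro: card_ge_0_finite)
    show "active J A p \<subseteq> J - I" using p ijk by auto
  qed
  then obtain P Q where PQ: "det P \<noteq> 0" "det Q \<noteq> 0" "P ** mat2 1 0 0 0 ** Q = p"
    using rank_one_normal_form p(1) by blast
  obtain A' B' C' where dec': "matmul_decomp J A' B' C'"
    and A': "\<And>s X. trace (A' s ** X) = trace (A s ** (P ** X ** Q))"
    by (rule matmul_decomp_change_basis[OF dec PQ(1,2)]) auto
  show False
    using no_triple_kernel_E11[OF dec' J, of i j k] I ijk p PQ(3) by (simp add: A')
qed

subsection \<open>Schmidt rank seven\<close>

definition shift3 :: op3 where "shift3 = monomial_mat (\<lambda>(a, b, c). (c, a, b)) (\<lambda>_. 1)"

lemma unitary_shift3: "unitary_mat shift3"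
  by (rule unitary_monomial_mat[OF shift3_def, where \<sigma> = "\<lambda>(a, b, c). (b, c, a)"]) auto

text \<open>The entry of \<open>kron3 X Y Z\<close> in row \<open>(c, a, b)\<close> and column
  \<open>(a, b, c)\<close> is \<open>X$c$a * Y$a$b * Z$b$c\<close>.\<close>

lemma trace_shift3: "trace (shift3 ** kron3 X Y Z) = trace (X ** Y ** Z)"
proof -
  have "trace (shift3 ** kron3 X Y Z) = (\<Sum>p\<in>UNIV. kron3 X Y Z $ (case p of (a, b, c) \<Rightarrow> (c, a, b)) $ p)"
    by (simp add: shift3_def monomial_mat_def trace_def matrix_matrix_mult_def
      if_distrib[of "\<lambda>x. x * _"] cong: if_cong)
  also have "\<dots> = trace (X ** Y ** Z)"
    by (simp add: sum_idx3 sum_2 kron3_def trace_2 matrix_mult_2 algebra_simps)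
  finally show ?thesis .
qed

lemma sum_of_kron3_shift3: "sum_of_kron3 7 shift3"
proof -
  \<comment> \<open>Strassen's seven products, one per summand.\<close>
  have "shift3 = 0 + kron3 (mat2 1 0 0 1) (mat2 1 0 0 1) (mat2 1 0 0 1)
    + kron3 (mat2 0 1 0 1) (mat2 1 0 0 0) (mat2 0 0 1 (-1))
    + kron3 (mat2 1 0 0 0) (mat2 0 0 1 (-1)) (mat2 0 1 0 1)
    + kron3 (mat2 0 0 0 1) (mat2 (-1) 1 0 0) (mat2 1 0 1 0)
    + kron3 (mat2 1 0 1 0) (mat2 0 0 0 1) (mat2 (-1) 1 0 0)
    + kron3 (mat2 (-1) 1 0 0) (mat2 1 0 1 0) (mat2 0 0 0 1)
    + kron3 (mat2 0 0 1 (-1)) (mat2 0 1 0 1) (mat2 1 0 0 0)" (is "_ = ?S")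
    by (simp add: shift3_def monomial_mat_def kron3_def vec_eq_iff forall_2)
  moreover have "sum_of_kron3 (Suc (Suc (Suc (Suc (Suc (Suc (Suc 0))))))) ?S"
    by (intro sum_of_kron3_Suc sum_of_kron3_0)
  ultimately show ?thesis by (simp add: numeral_eq_Suc)
qed

lemma shift3_ge:
  assumes "sum_of_kron3 s shift3"
  shows "7 \<le> s"
proof (rule ccontr)
  assume "\<not> 7 \<le> s"
  then have "sum_of_kron3 6 shift3" using assms sum_of_kron3_mono by simp
  then obtain A B C :: "nat \<Rightarrow> qubit_op" where U: "shift3 = (\<Sum>j<6. kron3 (A j) (B j) (C j))"
    by (auto simp: sum_of_kron3_def)
  have "matmul_decomp {..<6} A B C"
    unfolding matmul_decomp_def trace_shift3[symmetric] U trace_sum_kron3 by simp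
  then show False using no_matmul_decomp_6 by fastforce
qed

theorem theorem3:
  shows "\<forall>r \<in> {1..7::nat}. \<exists>U :: op3. unitary_mat U \<and> schmidt_rank U = r"
proof
  \<comment> \<open>These steps carry a too short decomposition up to \<open>chain4\<close> or
    \<open>pencil6\<close>, where the lower bound refutes it.\<close>
  have le2: "sum_of_kron3 (Suc s) chain2" if "sum_of_kron3 s chain1" for s
    unfolding chain2_def using that by (rule sum_of_kron3_Suc)
  have le3: "sum_of_kron3 (Suc s) chain3" if "sum_of_kron3 s chain2" for s
    unfolding chain3_def using that by (rule sum_of_kron3_Suc)
  have le4: "sum_of_kron3 (Suc s) chain4" if "sum_of_kron3 s chain3" for s
    unfolding chain4_def using that by (rule sum_of_kron3_Suc)
  have le6: "sum_of_kron3 (Suc s) pencil6" if "sum_of_kron3 s pencil5" for s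
    unfolding pencil6_def using that by (rule sum_of_kron3_Suc)
  have 1: "schmidt_rank chain1 = 1"
    using sum_of_kron3_chain1 by (rule schmidt_rank_eqI) (use chain4_ge le2 le3 le4 in fastforce)
  have up2: "sum_of_kron3 2 chain2"
    using le2[OF sum_of_kron3_chain1] by (simp add: numeral_2_eq_2)
  then have 2: "schmidt_rank chain2 = 2"
    by (rule schmidt_rank_eqI) (use chain4_ge le3 le4 in fastforce)
  have up3: "sum_of_kron3 3 chain3"
    using le3[OF up2] by simp
  then have 3: "schmidt_rank chain3 = 3"
    by (rule schmidt_rank_eqI) (use chain4_ge le4 in fastforce)
  have "sum_of_kron3 4 chain4"
    using le4[OF up3] by simp
  then have 4: "schmidt_rank chain4 = 4"
    using chain4_ge by (rule schmidt_rank_eqI)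
  have 5: "schmidt_rank pencil5 = 5"
    using sum_of_kron3_pencil5 by (rule schmidt_rank_eqI) (use pencil6_ge le6 in fastforce)
  have "sum_of_kron3 6 pencil6"
    using le6[OF sum_of_kron3_pencil5] by simp
  then have 6: "schmidt_rank pencil6 = 6"
    using pencil6_ge by (rule schmidt_rank_eqI)
  have 7: "schmidt_rank shift3 = 7"
    using sum_of_kron3_shift3 shift3_ge by (rule schmidt_rank_eqI)
  fix r :: nat
  assume "r \<in> {1..7}"
  then consider "r = 1" | "r = 2" | "r = 3" | "r = 4" | "r = 5" | "r = 6" | "r = 7"
    by fastforce
  then show "\<exists>U :: op3. unitary_mat U \<and> schmidt_rank U = r"
    by cases (use 1 2 3 4 5 6 7 unitary_chain1 unitary_chain2 unitary_chain3 unitary_chain4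
      unitary_pencil5 unitary_pencil6 unitary_shift3 in blast)+
qed

end
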